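(* Let $n\ge 1$ and let $\mathcal{A}_n=\{(ij|K): K\subseteq[n],\ i\neq j\in[n]\setminus K\}$, where $(ij|K)$ and $(ji|K)$ denote the same element. For a matroid $M$ on $[n]$ with rank function $r$ put \[[[M]]=\{(ij|K)\in\mathcal{A}_n: r(iK)+r(jK)=r(ijK)+r(K)\}.\] A subset $\mathcal{G}\subseteq\mathcal{A}_n$ satisfies $\mathcal{G}=[[M]]$ for some loopless matroid $M$ on $[n]$ if and only if $\mathcal{G}$ satisfies both of the following conditions: (MCI) for all pairwise distinct $i,j,\ell\in[n]$ and all disjoint $K,L\subseteq[n]\setminus\{i,j,\ell\}$: if $(ij|K)\notin\mathcal{G}$, then $(i\ell|jKL)\in\mathcal{G}$; (SG) for all pairwise distinct $i,j,\ell\in[n]$ and all $K\subseteq[n]\setminus\{i,j,\ell\}$: if $(ij|K)\in\mathcal{G}$ and $(i\ell|jK)\in\mathcal{G}$, then $(i\ell|K)\in\mathcal{G}$ and $(ij|\ell K)\in\mathcal{G}$. Moreover, the map $M\mapsto[[M]]$ is a bijection from the set of loopless matroids on $[n]$ to the set of subsets of $\mathcal{A}_n$ satisfying (MCI) and (SG).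
   Context: Notation: concatenation of letters denotes disjoint union of sets; lower-case letters denote singletons, upper-case letters denote (possibly empty) subsets. Thus $iK=\{i\}\cup K$, $ijK=\{i,j\}\cup K$, $jKL=\{j\}\cup K\cup L$, etc., with all the indicated sets pairwise disjoint. A matroid is loopless if it has no loop (no element $e$ with $r(\{e\})=0$). *)

theory Defs
  imports Main
begin

text \<open>A matroid on the finite ground set \<open>E\<close> is given by its family \<open>\<I>\<close> of independent sets,
  so two matroids on \<open>E\<close> are equal iff they have the same independent sets.\<close>

definition matroid :: "'a set \<Rightarrow> 'a set set \<Rightarrow> bool" where
  "matroid E \<I> \<longleftrightarrow>
     finite E \<and>
     (\<forall>X\<in>\<I>. X \<subseteq> E) \<and>
     {} \<in> \<I> \<and>
     (\<forall>X Y. Y \<in> \<I> \<and> X \<subseteq> Y \<longrightarrow> X \<in> \<I>) \<and>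
     (\<forall>X Y. X \<in> \<I> \<and> Y \<in> \<I> \<and> card X < card Y \<longrightarrow> (\<exists>y\<in>Y - X. insert y X \<in> \<I>))"

definition rank :: "'a set set \<Rightarrow> 'a set \<Rightarrow> nat" where
  "rank \<I> X = Max {card Y | Y. Y \<in> \<I> \<and> Y \<subseteq> X}"

definition loopless :: "'a set \<Rightarrow> 'a set set \<Rightarrow> bool" where
  "loopless E \<I> \<longleftrightarrow> \<not> (\<exists>e\<in>E. rank \<I> {e} = 0)"

definition loopless_matroids :: "nat \<Rightarrow> nat set set set" where
  "loopless_matroids n = {M. matroid {1..n} M \<and> loopless {1..n} M}"

text \<open>The symbol \<open>(ij|K)\<close> is the pair \<open>({i, j}, K)\<close>; the unordered first component identifies
  \<open>(ij|K)\<close> with \<open>(ji|K)\<close>.\<close>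

type_synonym ci = "nat set \<times> nat set"

definition ci :: "nat \<Rightarrow> nat \<Rightarrow> nat set \<Rightarrow> ci" where
  "ci i j K = ({i, j}, K)"

definition CI :: "nat \<Rightarrow> ci set" where
  "CI n = {ci i j K | i j K. K \<subseteq> {1..n} \<and> i \<in> {1..n} - K \<and> j \<in> {1..n} - K \<and> i \<noteq> j}"

definition ci_structure :: "nat \<Rightarrow> nat set set \<Rightarrow> ci set" where
  "ci_structure n M =
     {ci i j K | i j K.
        K \<subseteq> {1..n} \<and> i \<in> {1..n} - K \<and> j \<in> {1..n} - K \<and> i \<noteq> j \<and>
        rank M (insert i K) + rank M (insert j K) = rank M (insert i (insert j K)) + rank M K}"

definition MCI :: "nat \<Rightarrow> ci set \<Rightarrow> bool" where
  "MCI n G \<longleftrightarrow>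
     (\<forall>i\<in>{1..n}. \<forall>j\<in>{1..n}. \<forall>l\<in>{1..n}. \<forall>K L.
        i \<noteq> j \<and> i \<noteq> l \<and> j \<noteq> l \<and>
        K \<subseteq> {1..n} - {i, j, l} \<and> L \<subseteq> {1..n} - {i, j, l} \<and> K \<inter> L = {} \<and>
        ci i j K \<notin> G \<longrightarrow> ci i l (insert j (K \<union> L)) \<in> G)"

definition SG :: "nat \<Rightarrow> ci set \<Rightarrow> bool" where
  "SG n G \<longleftrightarrow>
     (\<forall>i\<in>{1..n}. \<forall>j\<in>{1..n}. \<forall>l\<in>{1..n}. \<forall>K.
        i \<noteq> j \<and> i \<noteq> l \<and> j \<noteq> l \<and> K \<subseteq> {1..n} - {i, j, l} \<and>
        ci i j K \<in> G \<and> ci i l (insert j K) \<in> G \<longrightarrow>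
        ci i l K \<in> G \<and> ci i j (insert l K) \<in> G)"

end

theory Submission
  imports Defs
begin

text \<open>
  For a loopless matroid and \<open>i \<notin> K\<close>, adding the elements of \<open>K\<close> one at a time to the empty set
  shows that \<open>i\<close> lies in the closure of \<open>K\<close> iff \<open>(ij|L) \<notin> [[M]]\<close> for some \<open>jL \<subseteq> K\<close>. Conversely,
  given \<open>\<G>\<close> with (MCI) and (SG), take this as the definition of closure. By (SG) the chain from
  the empty set to \<open>K\<close> along which one looks for a missing \<open>(ij|L)\<close> is irrelevant, and by (MCI) at
  most one is missing on each chain. Hence the indicator \<open>f\<^sub>i(K)\<close> of \<open>i\<close> being in the closure of \<open>K\<close>
  satisfies \<open>f\<^sub>i(jK) - f\<^sub>i(K) = 1\<close> if \<open>(ij|K) \<notin> \<G>\<close> and \<open>0\<close> otherwise. As this difference is symmetric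
  in \<open>i\<close> and \<open>j\<close>, \<open>r(iK) = r(K) + 1 - f\<^sub>i(K)\<close> consistently defines a function \<open>r\<close>, which is the rank
  function of a loopless matroid. The rank function, and so the matroid, is recovered from
  \<open>[[M]]\<close> by recursion on the size of the set.
\<close>

section \<open>Matroid rank functions\<close>

text \<open>The rank axioms in local form, about adding one or two elements: this is the form in
  which an increment can be read off a single symbol \<open>(ij|K)\<close>.\<close>

locale rank_function =
  fixes E :: "'a set" and r :: "'a set \<Rightarrow> nat"
  assumes finite_ground: "finite E"
    and rank_empty: "r {} = 0"
    and rank_le_insert: "\<lbrakk>A \<subseteq> E; i \<in> E\<rbrakk> \<Longrightarrow> r A \<le> r (insert i A)"
    and rank_insert_le: "\<lbrakk>A \<subseteq> E; i \<in> E\<rbrakk> \<Longrightarrow> r (insert i A) \<le> Suc (r A)"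
    and rank_submod: "\<lbrakk>A \<subseteq> E; i \<in> E; j \<in> E\<rbrakk> \<Longrightarrow>
      r (insert i (insert j A)) + r A \<le> r (insert i A) + r (insert j A)"
begin

lemma finite_subset_ground: "A \<subseteq> E \<Longrightarrow> finite A"
  using finite_ground finite_subset by blast

lemma rank_le_Un:
  assumes "A \<subseteq> E" "B \<subseteq> E"
  shows "r A \<le> r (A \<union> B)"
  using finite_subset_ground[OF assms(2)] assms(2)
proof (induction B rule: finite_induct)
  case (insert x B)
  then have "r (A \<union> B) \<le> r (insert x (A \<union> B))"
    using assms(1) by (intro rank_le_insert) auto
  with insert show ?case by auto
qed simp

lemma rank_mono: "\<lbrakk>A \<subseteq> B; B \<subseteq> E\<rbrakk> \<Longrightarrow> r A \<le> r B"
  using rank_le_Un[of A B] by (simp add: Un_absorb1)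

lemma rank_le_card:
  assumes "A \<subseteq> E"
  shows "r A \<le> card A"
  using finite_subset_ground[OF assms] assms
proof (induction A rule: finite_induct)
  case (insert x A)
  then show ?case using rank_insert_le[of A x] by simp
qed (simp add: rank_empty)

text \<open>Monotonicity of closure: local submodularity keeps the increment of \<open>i\<close> at
  zero as elements join \<open>A\<close> one by one.\<close>

lemma rank_insert_eq_mono:
  assumes "r (insert i A) = r A" "A \<subseteq> B" "B \<subseteq> E" "i \<in> E"
  shows "r (insert i B) = r B"
proof -
  have "r (insert i (A \<union> C)) = r (A \<union> C)" if "finite C" "C \<subseteq> E" for C
    using that
  proof (induction C rule: finite_induct)
    case (insert x C)
    have sub: "A \<union> C \<subseteq> E" using insert.prems assms by auto
    have "r (insert i (A \<union> C)) = r (A \<union> C)" using insert by simp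
    with rank_submod[OF sub \<open>i \<in> E\<close>, of x] rank_le_insert[of "insert x (A \<union> C)" i] insert.prems sub
    show ?case using \<open>i \<in> E\<close> by simp
  qed (simp add: assms)
  from this[of B] show ?thesis
    using assms finite_subset_ground by (simp add: Un_absorb1)
qed

lemma rank_Un_eq:
  assumes "X \<subseteq> E" "Y \<subseteq> E" "\<And>y. y \<in> Y \<Longrightarrow> r (insert y X) = r X"
  shows "r (X \<union> Y) = r X"
  using finite_subset_ground[OF assms(2)] assms(2,3)
proof (induction Y rule: finite_induct)
  case (insert y Y)
  have "r (insert y (X \<union> Y)) = r (X \<union> Y)"
  proof (rule rank_insert_eq_mono)
    show "r (insert y X) = r X" by (rule insert.prems(2)) simp
  qed (use insert.prems(1) assms(1) in auto)
  moreover have "r (X \<union> Y) = r X"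
    by (rule insert.IH) (use insert.prems in auto)
  ultimately show ?case by simp
qed simp

section \<open>The matroid of a rank function\<close>

definition indep :: "'a set set" where
  "indep = {X. X \<subseteq> E \<and> r X = card X}"

text \<open>Heredity follows from unit increase. For exchange, if no element of \<open>Y\<close>
  augments \<open>X\<close>, then all of \<open>Y\<close> lies in the closure of \<open>X\<close>,
  so \<open>card Y = r Y \<le> r X = card X\<close>.\<close>

lemma matroid_indep: "matroid E indep"
  unfolding matroid_def
proof (intro conjI allI ballI impI)
  fix X Y assume *: "Y \<in> indep \<and> X \<subseteq> Y"
  have "r (X \<union> Z) \<le> r X + card Z" if "finite Z" "Z \<subseteq> E" for Z
    using that
  proof (induction Z rule: finite_induct)
    case (insert z Z)
    moreover have "X \<union> Z \<subseteq> E" using insert.prems * by (auto simp: indep_def)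
    ultimately show ?case using rank_insert_le[of "X \<union> Z" z] by simp
  qed simp
  from this[of "Y - X"] have "r Y \<le> r X + card (Y - X)"
    using * finite_subset_ground by (auto simp: indep_def Un_absorb1)
  moreover have "card Y = card X + card (Y - X)"
    using * finite_subset_ground[of Y]
    by (metis (no_types, lifting) add_diff_inverse_nat card_Diff_subset card_mono finite_subset
        indep_def linorder_not_less mem_Collect_eq)
  moreover have "r X \<le> card X" using * by (intro rank_le_card) (auto simp: indep_def)
  ultimately show "X \<in> indep" using * by (auto simp: indep_def)
next
  fix X Y assume *: "X \<in> indep \<and> Y \<in> indep \<and> card X < card Y"
  show "\<exists>y\<in>Y - X. insert y X \<in> indep"
  proof (rule ccontr)
    assume no: "\<not> ?thesis"
    have "r (insert y X) = r X" if "y \<in> Y" for y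
    proof (cases "y \<in> X")
      case False
      with no that have "insert y X \<notin> indep" by blast
      with * that False rank_insert_le[of X y] rank_le_insert[of X y] finite_subset_ground[of X]
      show ?thesis by (auto simp: indep_def)
    qed (simp add: insert_absorb)
    then have "r (X \<union> Y) = r X" using * by (intro rank_Un_eq) (auto simp: indep_def)
    moreover have "r Y \<le> r (X \<union> Y)" using * by (intro rank_mono) (auto simp: indep_def)
    ultimately show False using * by (auto simp: indep_def)
  qed
qed (use finite_ground rank_empty in \<open>auto simp: indep_def\<close>)

lemma ex_indep_card_eq_rank:
  assumes "A \<subseteq> E"
  shows "\<exists>Y\<in>indep. Y \<subseteq> A \<and> card Y = r A"
  using finite_subset_ground[OF assms] assms
proof (induction A rule: finite_induct)
  case empty
  then show ?case by (auto simp: indep_def rank_empty)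
next
  case (insert x A)
  then obtain Y where Y: "Y \<in> indep" "Y \<subseteq> A" "card Y = r A" by auto
  show ?case
  proof (cases "r (insert x A) = r A")
    case True
    then show ?thesis using Y by (intro bexI[of _ Y]) auto
  next
    case False
    have YE: "Y \<subseteq> E" "x \<in> E" using insert.prems Y by auto
    \<comment> \<open>Otherwise \<open>x\<close> would be in the closure of \<open>Y\<close>, hence
      in that of the larger set \<open>A\<close>.\<close>
    have "r (insert x Y) \<noteq> r Y"
      using False rank_insert_eq_mono[of x Y A] Y insert.prems by auto
    with rank_insert_le[OF YE] rank_le_insert[OF YE] Y
    have "r (insert x Y) = Suc (card Y)" by (simp add: indep_def)
    moreover have "r (insert x A) = Suc (r A)"
      using False rank_insert_le[of A x] rank_le_insert[of A x] insert.prems by auto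
    moreover have "x \<notin> Y" using insert Y by auto
    ultimately show ?thesis using Y YE finite_subset_ground[of Y]
      by (intro bexI[of _ "insert x Y"]) (auto simp: indep_def)
  qed
qed

lemma rank_indep:
  assumes "A \<subseteq> E"
  shows "rank indep A = r A"
  unfolding rank_def
proof (rule Max_eqI)
  have "{card Y |Y. Y \<in> indep \<and> Y \<subseteq> A} = card ` {Y\<in>indep. Y \<subseteq> A}" by auto
  also have "finite \<dots>"
    using finite_ground by (auto simp: indep_def intro!: finite_imageI finite_subset[of _ "Pow E"])
  finally show "finite {card Y |Y. Y \<in> indep \<and> Y \<subseteq> A}" .
next
  fix k assume "k \<in> {card Y |Y. Y \<in> indep \<and> Y \<subseteq> A}"
  then obtain Y where "Y \<in> indep" "Y \<subseteq> A" "k = card Y" by auto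
  then show "k \<le> r A" using rank_mono[OF _ assms, of Y] by (simp add: indep_def)
next
  show "r A \<in> {card Y |Y. Y \<in> indep \<and> Y \<subseteq> A}"
    using ex_indep_card_eq_rank[OF assms] by (simp add: Bex_def) metis
qed

end

section \<open>The rank function of a matroid\<close>

lemma matroid_finite_indep: "\<lbrakk>matroid E I; X \<in> I\<rbrakk> \<Longrightarrow> finite X"
  unfolding matroid_def by (meson finite_subset)

lemma matroid_hereditary: "\<lbrakk>matroid E I; Y \<in> I; X \<subseteq> Y\<rbrakk> \<Longrightarrow> X \<in> I"
  unfolding matroid_def by blast

lemma finite_indep_cards:
  assumes "matroid E I"
  shows "finite {card Y |Y. Y \<in> I \<and> Y \<subseteq> A}"
proof -
  have "{card Y |Y. Y \<in> I \<and> Y \<subseteq> A} = card ` {Y\<in>I. Y \<subseteq> A}" by auto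
  also have "finite \<dots>"
    using assms by (auto simp: matroid_def intro!: finite_imageI finite_subset[of _ "Pow E"])
  finally show ?thesis .
qed

lemma card_le_rank:
  assumes "matroid E I" "Y \<in> I" "Y \<subseteq> A"
  shows "card Y \<le> rank I A"
  unfolding rank_def using finite_indep_cards[OF assms(1)] assms(2,3) by (intro Max_ge) auto

lemma obtain_indep_card_eq_rank:
  assumes "matroid E I"
  obtains Y where "Y \<in> I" "Y \<subseteq> A" "card Y = rank I A"
proof -
  have "{} \<in> I" using assms by (auto simp: matroid_def)
  then have "{card Y |Y. Y \<in> I \<and> Y \<subseteq> A} \<noteq> {}" by auto
  from Max_in[OF finite_indep_cards[OF assms] this] show ?thesis
    using that unfolding rank_def by auto
qed

text \<open>Exchange against a largest independent subset of \<open>A\<close> shrinks the deficit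
  \<open>rank I A - card X\<close> by one each time.\<close>

lemma extend_to_rank:
  assumes M: "matroid E I" and X: "X \<in> I" "X \<subseteq> A"
  obtains B where "B \<in> I" "X \<subseteq> B" "B \<subseteq> A" "card B = rank I A"
proof -
  have "\<exists>B\<in>I. X \<subseteq> B \<and> B \<subseteq> A \<and> card B = rank I A"
    using X
  proof (induction "rank I A - card X" arbitrary: X rule: less_induct)
    case less
    show ?case
    proof (cases "card X < rank I A")
      case True
      obtain Y where Y: "Y \<in> I" "Y \<subseteq> A" "card Y = rank I A"
        using obtain_indep_card_eq_rank[OF M] .
      with True less.prems M obtain y where y: "y \<in> Y - X" "insert y X \<in> I"
        unfolding matroid_def by metis
      have "rank I A - card (insert y X) < rank I A - card X"
        using True y matroid_finite_indep[OF M less.prems(1)] by simp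
      with less.hyps[of "insert y X"] y Y less.prems show ?thesis by auto
    next
      case False
      with card_le_rank[OF M less.prems] less.prems show ?thesis by auto
    qed
  qed
  with that show ?thesis by blast
qed

lemma rank_function_rank:
  assumes M: "matroid E I"
  shows "rank_function E (rank I)"
proof
  show "finite E" using M by (simp add: matroid_def)
  obtain Y where "Y \<in> I" "Y \<subseteq> {}" "card Y = rank I {}"
    using obtain_indep_card_eq_rank[OF M] .
  then show "rank I {} = 0" by simp
next
  fix A i assume "A \<subseteq> E" "i \<in> E"
  obtain Y where Y: "Y \<in> I" "Y \<subseteq> A" "card Y = rank I A"
    using obtain_indep_card_eq_rank[OF M] .
  then show "rank I A \<le> rank I (insert i A)"
    using card_le_rank[OF M Y(1), of "insert i A"] by auto
  obtain Z where Z: "Z \<in> I" "Z \<subseteq> insert i A" "card Z = rank I (insert i A)"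
    using obtain_indep_card_eq_rank[OF M] .
  have "card (Z - {i}) \<le> rank I A"
    using Z by (intro card_le_rank[OF M] matroid_hereditary[OF M Z(1)]) auto
  moreover have "card Z \<le> Suc (card (Z - {i}))"
    by (metis card_Suc_Diff1 diff_le_self card_Diff_singleton_if le_SucI le_refl matroid_finite_indep[OF M Z(1)])
  ultimately show "rank I (insert i A) \<le> Suc (rank I A)" using Z by simp
next
  fix A i j assume "A \<subseteq> E" "i \<in> E" "j \<in> E"
  obtain B where B: "B \<in> I" "B \<subseteq> A" "card B = rank I A"
    using obtain_indep_card_eq_rank[OF M] .
  obtain C where C: "C \<in> I" "B \<subseteq> C" "C \<subseteq> insert i (insert j A)"
      "card C = rank I (insert i (insert j A))"
    using extend_to_rank[OF M B(1), of "insert i (insert j A)"] B(2) by auto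
  have fin: "finite C" using matroid_finite_indep[OF M C(1)] .
  \<comment> \<open>\<open>C\<close> extends the basis \<open>B\<close> of \<open>A\<close> to a
    basis of \<open>ijA\<close>. As \<open>B\<close> is maximal in \<open>A\<close>,
    \<open>C\<close> meets \<open>A\<close> only in \<open>B\<close>, and submodularity becomes
    inclusion-exclusion inside \<open>C\<close>.\<close>
  have "card (C \<inter> A) \<le> card B"
    unfolding B(3) using C by (intro card_le_rank[OF M] matroid_hereditary[OF M C(1)]) auto
  then have CA: "C \<inter> A = B" using B C fin by (intro card_seteq[symmetric]) auto
  have 1: "card (C \<inter> insert i A) \<le> rank I (insert i A)"
    "card (C \<inter> insert j A) \<le> rank I (insert j A)"
    by (auto intro!: card_le_rank[OF M] matroid_hereditary[OF M C(1)])
  have "card ((C \<inter> insert i A) \<union> (C \<inter> insert j A)) + card ((C \<inter> insert i A) \<inter> (C \<inter> insert j A))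
      = card (C \<inter> insert i A) + card (C \<inter> insert j A)"
    using card_Un_Int[of "C \<inter> insert i A" "C \<inter> insert j A"] fin by simp
  moreover have "card ((C \<inter> insert i A) \<union> (C \<inter> insert j A)) = card C"
    using C by (intro arg_cong[of _ _ card]) auto
  moreover have "card B \<le> card ((C \<inter> insert i A) \<inter> (C \<inter> insert j A))"
    using CA fin by (intro card_mono) auto
  ultimately show "rank I (insert i (insert j A)) + rank I A \<le> rank I (insert i A) + rank I (insert j A)"
    using 1 B(3) C(4) by linarith
qed

lemma indep_iff_rank_eq_card:
  assumes M: "matroid E I"
  shows "X \<in> I \<longleftrightarrow> X \<subseteq> E \<and> rank I X = card X"
proof
  assume X: "X \<in> I"
  then have "X \<subseteq> E" using M by (auto simp: matroid_def)
  then show "X \<subseteq> E \<and> rank I X = card X"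
    using card_le_rank[OF M X subset_refl] rank_function.rank_le_card[OF rank_function_rank[OF M]]
    by (simp add: le_antisym)
next
  assume X: "X \<subseteq> E \<and> rank I X = card X"
  obtain Y where Y: "Y \<in> I" "Y \<subseteq> X" "card Y = rank I X"
    using obtain_indep_card_eq_rank[OF M] .
  have "finite X" using X M by (auto simp: matroid_def intro: finite_subset)
  then have "Y = X" using X Y by (intro card_subset_eq) auto
  with Y show "X \<in> I" by simp
qed

section \<open>Conditional independence structures of matroids\<close>

lemma ci_commute: "ci i j K = ci j i K"
  by (simp add: ci_def insert_commute)

lemma ci_in_CI:
  "ci i j K \<in> CI n \<longleftrightarrow> K \<subseteq> {1..n} \<and> i \<in> {1..n} - K \<and> j \<in> {1..n} - K \<and> i \<noteq> j"
  by (auto simp: CI_def ci_def doubleton_eq_iff)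

lemma ci_in_ci_structure:
  "ci i j K \<in> ci_structure n M \<longleftrightarrow> ci i j K \<in> CI n \<and>
     rank M (insert i K) + rank M (insert j K) = rank M (insert i (insert j K)) + rank M K"
  unfolding ci_in_CI by (auto simp: ci_structure_def ci_def doubleton_eq_iff insert_commute add.commute)

lemma ci_structure_subset: "ci_structure n M \<subseteq> CI n"
  by (auto simp: ci_structure_def CI_def)

text \<open>A missing \<open>(ij|K)\<close> means strict submodularity, which by unit increase
  forces \<open>i\<close> into the closure of \<open>jK\<close>. It stays in the closure of every
  larger set, so both increments compared by \<open>(il|jKL)\<close> are zero.\<close>

lemma MCI_ci_structure:
  assumes "matroid {1..n} M"
  shows "MCI n (ci_structure n M)"
  unfolding MCI_def
proof (intro ballI allI impI)
  interpret rank_function "{1..n}" "rank M" using rank_function_rank[OF assms] .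
  fix i j l K L
  assume E: "i \<in> {1..n}" "j \<in> {1..n}" "l \<in> {1..n}"
    and "i \<noteq> j \<and> i \<noteq> l \<and> j \<noteq> l \<and> K \<subseteq> {1..n} - {i, j, l} \<and> L \<subseteq> {1..n} - {i, j, l} \<and>
      K \<inter> L = {} \<and> ci i j K \<notin> ci_structure n M"
  then have neq: "i \<noteq> j" "i \<noteq> l" "j \<noteq> l" and K: "K \<subseteq> {1..n} - {i, j, l}"
    and L: "L \<subseteq> {1..n} - {i, j, l}" and no: "ci i j K \<notin> ci_structure n M" by auto
  have KE: "K \<subseteq> {1..n}" "insert j K \<subseteq> {1..n}" "insert j (K \<union> L) \<subseteq> {1..n}"
    "insert l (insert j (K \<union> L)) \<subseteq> {1..n}" using K L E by auto
  have "rank M (insert i K) + rank M (insert j K) \<noteq> rank M (insert i (insert j K)) + rank M K"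
    using no E K neq by (auto simp: ci_in_ci_structure ci_in_CI)
  then have *: "rank M (insert i (insert j K)) = rank M (insert j K)"
    using rank_submod[OF KE(1) E(1,2)] rank_insert_le[OF KE(1) E(1)]
      rank_le_insert[OF KE(2) E(1)] by linarith
  have "rank M (insert i (insert j (K \<union> L))) = rank M (insert j (K \<union> L))"
    by (rule rank_insert_eq_mono[OF * _ KE(3) E(1)]) auto
  moreover have "rank M (insert i (insert l (insert j (K \<union> L)))) = rank M (insert l (insert j (K \<union> L)))"
    by (rule rank_insert_eq_mono[OF * _ KE(4) E(1)]) auto
  ultimately show "ci i l (insert j (K \<union> L)) \<in> ci_structure n M"
    using E K L neq by (auto simp: ci_in_ci_structure ci_in_CI)
qed

lemma SG_ci_structure:
  assumes "matroid {1..n} M"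
  shows "SG n (ci_structure n M)"
  unfolding SG_def
proof (intro ballI allI impI)
  interpret rank_function "{1..n}" "rank M" using rank_function_rank[OF assms] .
  fix i j l K
  assume E: "i \<in> {1..n}" "j \<in> {1..n}" "l \<in> {1..n}"
    and *: "i \<noteq> j \<and> i \<noteq> l \<and> j \<noteq> l \<and> K \<subseteq> {1..n} - {i, j, l} \<and>
      ci i j K \<in> ci_structure n M \<and> ci i l (insert j K) \<in> ci_structure n M"
  then have KE: "K \<subseteq> {1..n}" "insert l K \<subseteq> {1..n}" by auto
  \<comment> \<open>The sum of the two given equalities equals the sum of the submodular
    inequalities for \<open>(il|K)\<close> and \<open>(ij|lK)\<close>, taken as equalities. Hence
    both of these are tight.\<close>
  have "rank M (insert i K) + rank M (insert l K) = rank M (insert i (insert l K)) + rank M K \<and>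
    rank M (insert i (insert l K)) + rank M (insert j (insert l K)) =
      rank M (insert i (insert j (insert l K))) + rank M (insert l K)"
    using * rank_submod[OF KE(1) E(1,3)] rank_submod[OF KE(2) E(1,2)]
    by (simp add: ci_in_ci_structure insert_commute[of l j])
  then show "ci i l K \<in> ci_structure n M \<and> ci i j (insert l K) \<in> ci_structure n M"
    using * E by (auto simp: ci_in_ci_structure ci_in_CI)
qed

section \<open>Injectivity on loopless matroids\<close>

lemma rank_singleton_loopless:
  assumes "matroid {1..n} M" "loopless {1..n} M" "e \<in> {1..n}"
  shows "rank M {e} = 1"
proof -
  interpret rank_function "{1..n}" "rank M" using rank_function_rank[OF assms(1)] .
  show ?thesis
    using rank_le_card[of "{e}"] assms(2,3) by (force simp: loopless_def)
qed

text \<open>Looplessness fixes the rank of singletons. From there, the rank of \<open>ijK\<close> is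
  \<open>r(iK) + r(jK) - r(K)\<close> if \<open>(ij|K)\<close> is present and one less
  otherwise.\<close>

lemma rank_determined_by_ci_structure:
  assumes M: "matroid {1..n} M" "loopless {1..n} M"
    and N: "matroid {1..n} N" "loopless {1..n} N"
    and eq: "ci_structure n M = ci_structure n N"
    and "A \<subseteq> {1..n}"
  shows "rank M A = rank N A"
  using \<open>A \<subseteq> {1..n}\<close>
proof (induction "card A" arbitrary: A rule: less_induct)
  case less
  interpret M: rank_function "{1..n}" "rank M" using rank_function_rank[OF M(1)] .
  interpret N: rank_function "{1..n}" "rank N" using rank_function_rank[OF N(1)] .
  have fin: "finite A" using less.prems M.finite_subset_ground by blast
  consider "A = {}" | i where "A = {i}" | i j K where "A = insert i (insert j K)" "i \<noteq> j" "i \<notin> K" "j \<notin> K"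
    by (metis insertI1 insert_iff Set.set_insert all_not_in_conv)
  then show ?case
  proof cases
    case 1
    then show ?thesis by (simp add: M.rank_empty N.rank_empty)
  next
    case 2
    then show ?thesis using rank_singleton_loopless[OF M] rank_singleton_loopless[OF N] less.prems by simp
  next
    case 3
    then have E: "K \<subseteq> {1..n}" "i \<in> {1..n}" "j \<in> {1..n}" "insert j K \<subseteq> {1..n}"
      using less.prems by auto
    have IH: "rank M K = rank N K" "rank M (insert i K) = rank N (insert i K)"
      "rank M (insert j K) = rank N (insert j K)"
      using 3 fin E by (auto intro!: less.hyps)
    have "ci i j K \<in> ci_structure n M \<longleftrightarrow> ci i j K \<in> ci_structure n N" using eq by simp
    moreover have "ci i j K \<in> CI n" using 3 E by (simp add: ci_in_CI)
    ultimately have "rank M (insert i K) + rank M (insert j K) = rank M A + rank M K \<longleftrightarrow>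
      rank N (insert i K) + rank N (insert j K) = rank N A + rank N K"
      unfolding ci_in_ci_structure 3 by blast
    moreover note M.rank_submod[OF E(1-3)] M.rank_insert_le[OF E(1,2)] M.rank_le_insert[OF E(4,2)]
      N.rank_submod[OF E(1-3)] N.rank_insert_le[OF E(1,2)] N.rank_le_insert[OF E(4,2)]
    ultimately show ?thesis using IH unfolding 3 by linarith
  qed
qed

lemma inj_on_ci_structure: "inj_on (ci_structure n) (loopless_matroids n)"
proof (rule inj_onI)
  fix M N assume "M \<in> loopless_matroids n" "N \<in> loopless_matroids n"
    and eq: "ci_structure n M = ci_structure n N"
  then have M: "matroid {1..n} M" "loopless {1..n} M" and N: "matroid {1..n} N" "loopless {1..n} N"
    by (auto simp: loopless_matroids_def)
  show "M = N"
    using indep_iff_rank_eq_card[OF M(1)] indep_iff_rank_eq_card[OF N(1)]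
      rank_determined_by_ci_structure[OF M N eq] by auto
qed

section \<open>Reconstructing the matroid\<close>

text \<open>Closure membership is encoded only for \<open>i \<notin> K\<close>; for \<open>i \<in> K\<close> the predicate is not meaningful.\<close>

definition spanned :: "ci set \<Rightarrow> nat set \<Rightarrow> nat \<Rightarrow> bool" where
  "spanned G K i \<longleftrightarrow> (\<exists>j\<in>K. \<exists>L \<subseteq> K - {j}. ci i j L \<notin> G)"

text \<open>The natural order of the elements serves as the chain along which the rank increases.\<close>

definition ci_rank :: "ci set \<Rightarrow> nat set \<Rightarrow> nat" where
  "ci_rank G K = card {x\<in>K. \<not> spanned G {y\<in>K. y < x} x}"

locale matroid_ci =
  fixes n :: nat and G :: "ci set"
  assumes MCI: "MCI n G" and SG: "SG n G"
begin

text \<open>This is where (MCI) enters: on a chain, nothing can be missing for \<open>i\<close>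
  after the first missing symbol.\<close>

lemma spanned_imp_ci:
  assumes "spanned G K i" "K \<subseteq> {1..n}" "i \<in> {1..n} - K" "j \<in> {1..n} - K" "i \<noteq> j"
  shows "ci i j K \<in> G"
proof -
  obtain l L where l: "l \<in> K" "L \<subseteq> K - {l}" "ci i l L \<notin> G"
    using assms(1) unfolding spanned_def by blast
  \<comment> \<open>The rest of \<open>K\<close> takes the place of \<open>L\<close> in (MCI), so
    that the conditioning set is exactly \<open>K\<close>.\<close>
  have "ci i j (insert l (L \<union> (K - {l} - L))) \<in> G"
  proof (rule MCI[unfolded MCI_def, rule_format])
    show "i \<in> {1..n}" "l \<in> {1..n}" "j \<in> {1..n}" using assms l(1) by auto
    show "i \<noteq> l \<and> i \<noteq> j \<and> l \<noteq> j \<and> L \<subseteq> {1..n} - {i, l, j} \<and> K - {l} - L \<subseteq> {1..n} - {i, l, j} \<and>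
      L \<inter> (K - {l} - L) = {} \<and> ci i l L \<notin> G"
      using assms(2-5) l by blast
  qed
  moreover have "insert l (L \<union> (K - {l} - L)) = K" using l by auto
  ultimately show ?thesis by simp
qed

text \<open>The chain independence given by (SG): a new witness below \<open>jK\<close> can exist
  only if \<open>(ij|K)\<close> itself is missing or \<open>K\<close> already has a witness.\<close>

lemma spanned_insert:
  assumes "K \<subseteq> {1..n}" "i \<in> {1..n} - K" "j \<in> {1..n} - K" "i \<noteq> j"
  shows "spanned G (insert j K) i \<longleftrightarrow> spanned G K i \<or> ci i j K \<notin> G"
proof
  assume "spanned G K i \<or> ci i j K \<notin> G"
  then show "spanned G (insert j K) i" using assms unfolding spanned_def by blast
next
  show "spanned G K i \<or> ci i j K \<notin> G" if sp: "spanned G (insert j K) i"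
  proof (rule ccontr)
    assume "\<not> (spanned G K i \<or> ci i j K \<notin> G)"
    then have ijK: "ci i j K \<in> G" and *: "\<And>l L. \<lbrakk>l \<in> K; L \<subseteq> K - {l}\<rbrakk> \<Longrightarrow> ci i l L \<in> G"
      unfolding spanned_def by blast+
    \<comment> \<open>(SG) with \<open>j\<close> and \<open>l\<close> exchanged. The first
      conclusion removes \<open>l\<close> from the condition of \<open>(ij|lL)\<close>, the second
      adds \<open>j\<close> to that of \<open>(il|L)\<close>.\<close>
    have SG': "ci i j L \<in> G \<and> ci i l (insert j L) \<in> G"
      if "ci i j (insert l L) \<in> G" "l \<in> K" "L \<subseteq> K - {l}" for l L
    proof (rule SG[unfolded SG_def, rule_format])
      show "i \<in> {1..n}" "l \<in> {1..n}" "j \<in> {1..n}" using assms that(2) by auto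
      show "i \<noteq> l \<and> i \<noteq> j \<and> l \<noteq> j \<and> L \<subseteq> {1..n} - {i, l, j} \<and>
        ci i l L \<in> G \<and> ci i j (insert l L) \<in> G"
        using *[OF that(2,3)] that assms by blast
    qed
    have "finite K" using assms(1) finite_subset by blast
    \<comment> \<open>Used from \<open>K\<close> downwards, (SG) transports \<open>(ij|K)\<close> to all subsets of \<open>K\<close>.\<close>
    have ij: "ci i j (K - D) \<in> G" if "finite D" "D \<subseteq> K" for D
      using that
    proof (induction D rule: finite_induct)
      case (insert l D)
      have "insert l (K - insert l D) = K - D" using insert by auto
      with insert SG'[of l "K - insert l D"] show ?case by auto
    qed (simp add: ijK)
    have ij: "ci i j L \<in> G" if "L \<subseteq> K" for L
      using ij[of "K - L"] that \<open>finite K\<close> by (simp add: double_diff)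
    obtain l L where l: "l \<in> insert j K" "L \<subseteq> insert j K - {l}" "ci i l L \<notin> G"
      using sp unfolding spanned_def by blast
    show False
    proof (cases "l = j")
      case True
      then show False using l ij[of L] assms by auto
    next
      case False
      then have "l \<in> K" using l by simp
      show False
      proof (cases "j \<in> L")
        case True
        then have "insert j (L - {j}) = L" by auto
        moreover have "ci i l (insert j (L - {j})) \<in> G"
          using SG'[of l "L - {j}"] ij[of "insert l (L - {j})"] l \<open>l \<in> K\<close> by auto
        ultimately show False using l by simp
      next
        case False
        then show False using *[OF \<open>l \<in> K\<close>, of L] l by auto
      qed
    qed
  qed
qed

section \<open>The rank function from closure increments\<close>

lemma ci_rank_insert_greater:
  assumes "finite K" "\<And>x. x \<in> K \<Longrightarrow> x < b"
  shows "ci_rank G (insert b K) = ci_rank G K + (if spanned G K b then 0 else 1)"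
proof -
  have 1: "{y \<in> insert b K. y < b} = K" using assms(2) by blast
  have 2: "{y \<in> insert b K. y < x} = {y \<in> K. y < x}" if "x \<in> K" for x
    using assms(2)[OF that] by auto
  have b: "b \<notin> K" using assms(2) by blast
  let ?new = "\<lambda>K x. \<not> spanned G {y \<in> K. y < x} x"
  have "{x \<in> insert b K. ?new (insert b K) x} =
      {x \<in> K. ?new (insert b K) x} \<union> {x \<in> {b}. ?new (insert b K) x}" by blast
  also have "{x \<in> K. ?new (insert b K) x} = {x \<in> K. ?new K x}"
    using 2 by (intro Collect_cong) (simp cong: conj_cong)
  also have "{x \<in> {b}. ?new (insert b K) x} = (if spanned G K b then {} else {b})"
    by (auto simp only: 1 split: if_splits)
  finally show ?thesis using assms(1) b by (simp add: ci_rank_def)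
qed

text \<open>Removes the dependence of \<open>ci_rank\<close> on the natural order: any element may
  be treated as the last one added. The induction peels off the largest element \<open>b\<close>,
  and only \<open>i < b\<close> requires exchanging \<open>i\<close> with \<open>b\<close>.\<close>

lemma ci_rank_insert:
  assumes "K \<subseteq> {1..n}" "i \<in> {1..n} - K"
  shows "ci_rank G (insert i K) = ci_rank G K + (if spanned G K i then 0 else 1)"
proof -
  have "finite K" using assms(1) finite_subset by blast
  then show ?thesis using assms
  proof (induction K rule: finite_linorder_max_induct)
    case empty
    then show ?case by (intro ci_rank_insert_greater) auto
  next
    case (insert b A)
    consider "b < i" | "i < b" using insert.prems by fastforce
    then show ?case
    proof cases
      case 1
      then show ?thesis using insert by (intro ci_rank_insert_greater) auto
    next
      case 2
      have A: "A \<subseteq> {1..n}" "i \<in> {1..n} - A" "b \<in> {1..n} - A" "i \<noteq> b"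
        using insert.prems insert.hyps 2 by auto
      have "ci_rank G (insert b (insert i A)) =
          ci_rank G (insert i A) + (if spanned G (insert i A) b then 0 else 1)"
        using insert.hyps 2 by (intro ci_rank_insert_greater) auto
      moreover have "ci_rank G (insert i A) = ci_rank G A + (if spanned G A i then 0 else 1)"
        using insert.IH A by simp
      moreover have "ci_rank G (insert b A) = ci_rank G A + (if spanned G A b then 0 else 1)"
        using insert.hyps by (intro ci_rank_insert_greater) auto
      \<comment> \<open>The symbol \<open>(ib|A)\<close> governs both changes of closure. The
        exclusivity shown next turns each disjunction into a sum of indicators, so the two orders of
        insertion give the same total.\<close>
      moreover have "spanned G (insert b A) i \<longleftrightarrow> spanned G A i \<or> ci i b A \<notin> G"
        "spanned G (insert i A) b \<longleftrightarrow> spanned G A b \<or> ci i b A \<notin> G"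
        using spanned_insert[OF A] spanned_insert[OF A(1,3,2)] A(4) by (auto simp: ci_commute[of b i])
      moreover have "spanned G A i \<Longrightarrow> ci i b A \<in> G" "spanned G A b \<Longrightarrow> ci i b A \<in> G"
        using spanned_imp_ci[OF _ A] spanned_imp_ci[OF _ A(1,3,2)] A(4) by (auto simp: ci_commute[of b i])
      ultimately show ?thesis by (auto simp: insert_commute[of i b])
    qed
  qed
qed

lemma ci_rank_insert_insert:
  assumes "K \<subseteq> {1..n}" "i \<in> {1..n} - K" "j \<in> {1..n} - K" "i \<noteq> j"
  shows "ci_rank G (insert i K) + ci_rank G (insert j K) =
    ci_rank G (insert i (insert j K)) + ci_rank G K + (if ci i j K \<in> G then 0 else 1)"
proof -
  have "ci_rank G (insert i (insert j K)) =
      ci_rank G (insert j K) + (if spanned G (insert j K) i then 0 else 1)"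
    using assms by (intro ci_rank_insert) auto
  then show ?thesis
    using ci_rank_insert[OF assms(1,2)] spanned_insert[OF assms] spanned_imp_ci[OF _ assms] by auto
qed

sublocale rank_function "{1..n}" "ci_rank G"
proof
  show "finite {1..n}" "ci_rank G {} = 0" by (simp_all add: ci_rank_def)
next
  fix A i assume A: "A \<subseteq> {1..n}" "i \<in> {1..n}"
  show "ci_rank G A \<le> ci_rank G (insert i A)" "ci_rank G (insert i A) \<le> Suc (ci_rank G A)"
    using ci_rank_insert[OF A(1), of i] A(2) by (cases "i \<in> A"; simp add: insert_absorb)+
  fix j assume j: "j \<in> {1..n}"
  \<comment> \<open>Serves the degenerate case \<open>i = j\<close>, where submodularity reduces to
    monotonicity.\<close>
  have "ci_rank G A \<le> ci_rank G (insert j A)"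
    using ci_rank_insert[OF A(1), of j] j by (cases "j \<in> A"; simp add: insert_absorb)
  then show "ci_rank G (insert i (insert j A)) + ci_rank G A \<le> ci_rank G (insert i A) + ci_rank G (insert j A)"
    using ci_rank_insert_insert[OF A(1), of i j] A(2) j
    by (cases "i \<in> A"; cases "j \<in> A"; cases "i = j") (auto simp: insert_absorb)
qed

text \<open>The empty set has no witness and so spans nothing, whence every singleton gets rank
  one.\<close>

lemma loopless_indep: "loopless {1..n} indep"
  using ci_rank_insert[of "{}"] by (auto simp: loopless_def rank_indep spanned_def simp del: One_nat_def)

lemma ci_structure_indep:
  assumes "G \<subseteq> CI n"
  shows "ci_structure n indep = G"
proof -
  have "ci i j K \<in> ci_structure n indep \<longleftrightarrow> ci i j K \<in> G" if "ci i j K \<in> CI n" for i j K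
  proof -
    have K: "K \<subseteq> {1..n}" "i \<in> {1..n} - K" "j \<in> {1..n} - K" "i \<noteq> j"
      using that by (auto simp: ci_in_CI)
    then show ?thesis
      using that ci_rank_insert_insert[OF K] by (simp add: ci_in_ci_structure rank_indep del: One_nat_def)
  qed
  moreover have "x \<in> CI n \<Longrightarrow> \<exists>i j K. x = ci i j K" for x by (auto simp: CI_def)
  ultimately show ?thesis using assms ci_structure_subset by blast
qed

end

theorem theorem2p1:
  fixes n :: nat
  assumes "n \<ge> 1"
  shows "(\<forall>G. G \<subseteq> CI n \<longrightarrow>
            ((\<exists>M. matroid {1..n} M \<and> loopless {1..n} M \<and> G = ci_structure n M) \<longleftrightarrow>
             MCI n G \<and> SG n G)) \<and>
         bij_betw (ci_structure n) (loopless_matroids n) {G. G \<subseteq> CI n \<and> MCI n G \<and> SG n G}"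
proof -
  have surj: "\<exists>M. matroid {1..n} M \<and> loopless {1..n} M \<and> G = ci_structure n M"
    if "G \<subseteq> CI n" "MCI n G" "SG n G" for G
  proof -
    \<comment> \<open>Here \<open>indep\<close> is the family attached to \<open>ci_rank G\<close>,
      which supplies the preimage of \<open>G\<close>.\<close>
    interpret matroid_ci n G using that by unfold_locales
    show ?thesis using matroid_indep loopless_indep ci_structure_indep[OF that(1)] by blast
  qed
  then have "ci_structure n ` loopless_matroids n = {G. G \<subseteq> CI n \<and> MCI n G \<and> SG n G}"
    using MCI_ci_structure SG_ci_structure ci_structure_subset
    by (fastforce simp: loopless_matroids_def image_iff)
  then show ?thesis
    using surj inj_on_ci_structure MCI_ci_structure SG_ci_structure by (auto simp: bij_betw_def)
qed

end
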